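(* For a commutative ring $R$ the following statements are equivalent. (i) $\dim(R)=0$, i.e., every prime ideal of $R$ is maximal. (ii) If $\mathfrak{p}$ and $\mathfrak{q}$ are distinct prime ideals of $R$, then there exists an idempotent $e\in\mathfrak{p}\setminus\mathfrak{q}$. (iii) $\operatorname{Spec}(R)$ is totally disconnected. (iv) $\operatorname{Spec}(R)$ is homeomorphic to $\operatorname{Spec}\big(\mathcal{B}(R)\big)$.
   Context: All rings are commutative with $1$. $\mathcal{B}(R)=\{e\in R: e=e^{2}\}$ is the Boolean ring of $R$, with addition $e\oplus e'=e+e'-2ee'$ and multiplication $ee'$. Prime spectra carry the Zariski topology. A space is totally disconnected if its only nonempty connected subsets are singletons. *)

theory Defs
  imports "HOL-Analysis.Abstract_Topology" "HOL-Algebra.Ideal"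
begin

definition idempotents :: "('a, 'b) ring_scheme \<Rightarrow> 'a set" where
  "idempotents R = {e \<in> carrier R. e = e \<otimes>\<^bsub>R\<^esub> e}"

definition boolean_ring :: "('a, 'b) ring_scheme \<Rightarrow> 'a ring" where
  "boolean_ring R =
     \<lparr>carrier = idempotents R,
      mult = (\<lambda>e f. e \<otimes>\<^bsub>R\<^esub> f),
      one = \<one>\<^bsub>R\<^esub>,
      zero = \<zero>\<^bsub>R\<^esub>,
      add = (\<lambda>e f. (e \<oplus>\<^bsub>R\<^esub> f) \<ominus>\<^bsub>R\<^esub> (e \<otimes>\<^bsub>R\<^esub> f \<oplus>\<^bsub>R\<^esub> e \<otimes>\<^bsub>R\<^esub> f))\<rparr>"

text \<open>Rings may be trivial, since \<^const>\<open>cring\<close> does not exclude \<open>\<one> = \<zero>\<close>;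
  in that case the spectrum is the empty space.\<close>

lemma cring_boolean_ring:
  fixes R (structure)
  assumes "cring R"
  shows "cring (boolean_ring R)"
proof -
  interpret cring R by fact
  define s where "s = (\<lambda>e f. (e \<oplus> f) \<ominus> (e \<otimes> f \<oplus> e \<otimes> f))"
  have B [simp]: "carrier (boolean_ring R) = idempotents R"
    "mult (boolean_ring R) = mult R" "one (boolean_ring R) = one R"
    "zero (boolean_ring R) = zero R" "add (boolean_ring R) = s"
    by (simp_all add: boolean_ring_def s_def)
  have carr: "e \<in> carrier R" if "e \<in> idempotents R" for e
    using that by (simp add: idempotents_def)
  have idem: "e \<otimes> e = e" if "e \<in> idempotents R" for e
    using that by (simp add: idempotents_def)
  have idem': "e \<otimes> (e \<otimes> x) = e \<otimes> x" if "e \<in> idempotents R" "x \<in> carrier R" for e x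
    using that by (metis m_assoc idem carr)
  have mult_closed: "e \<otimes> f \<in> idempotents R"
    if "e \<in> idempotents R" "f \<in> idempotents R" for e f
  proof -
    have "(e \<otimes> f) \<otimes> (e \<otimes> f) = e \<otimes> f"
      using that by (simp add: carr idem idem' m_ac)
    then show ?thesis using that by (simp add: idempotents_def)
  qed
  have s_carr: "s x y \<in> carrier R" if "x \<in> carrier R" "y \<in> carrier R" for x y
    using that by (simp add: s_def)
  have distr: "x \<otimes> s y z = (x \<otimes> y \<oplus> x \<otimes> z) \<ominus> (x \<otimes> (y \<otimes> z) \<oplus> x \<otimes> (y \<otimes> z))"
    if "x \<in> carrier R" "y \<in> carrier R" "z \<in> carrier R" for x y z
    using that by (simp add: s_def a_minus_def r_distr r_minus)
  have s_comm: "s x y = s y x" if "x \<in> carrier R" "y \<in> carrier R" for x y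
    using that by (simp add: s_def a_comm m_comm)
  have s_assoc: "s (s x y) z = s x (s y z)"
    if "x \<in> carrier R" "y \<in> carrier R" "z \<in> carrier R" for x y z
    using that
    by (simp add: s_def a_minus_def r_distr l_distr l_minus r_minus minus_add a_ac m_ac)
  have cancel: "(x \<oplus> y) \<ominus> (y \<oplus> y) = x \<ominus> y" if "x \<in> carrier R" "y \<in> carrier R" for x y
    using that by (simp add: a_minus_def minus_add a_assoc r_neg2)
  have e_s: "e \<otimes> s e f = e \<ominus> e \<otimes> f" if "e \<in> idempotents R" "f \<in> idempotents R" for e f
  proof -
    have "e \<otimes> s e f = (e \<oplus> e \<otimes> f) \<ominus> (e \<otimes> f \<oplus> e \<otimes> f)"
      using that by (simp add: distr carr idem idem')
    also have "\<dots> = e \<ominus> e \<otimes> f" using that by (simp add: cancel carr)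
    finally show ?thesis .
  qed
  have s_closed: "s e f \<in> idempotents R"
    if ef: "e \<in> idempotents R" "f \<in> idempotents R" for e f
  proof -
    note c = carr[OF ef(1)] carr[OF ef(2)]
    have c': "s e f \<in> carrier R" using c by (rule s_carr)
    have f1: "s e f \<otimes> e = e \<ominus> e \<otimes> f" using e_s[OF ef] c c' by (simp add: m_comm)
    have f2: "s e f \<otimes> f = f \<ominus> e \<otimes> f"
      using e_s[OF ef(2,1)] s_comm[OF c] c c' by (simp add: m_comm)
    have f3: "s e f \<otimes> (e \<otimes> f) = \<zero>"
    proof -
      have "s e f \<otimes> (e \<otimes> f) = (e \<ominus> e \<otimes> f) \<otimes> f"
        using c c' f1 by (simp add: m_assoc[symmetric])
      also have "\<dots> = e \<otimes> f \<ominus> e \<otimes> (f \<otimes> f)"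
        using c by (simp add: a_minus_def l_distr l_minus m_assoc)
      finally show ?thesis using c idem[OF ef(2)] by (simp add: a_minus_def r_neg)
    qed
    have "s e f \<otimes> s e f = (s e f \<otimes> e \<oplus> s e f \<otimes> f) \<ominus> (s e f \<otimes> (e \<otimes> f) \<oplus> s e f \<otimes> (e \<otimes> f))"
      using c c' by (simp add: distr)
    also have "\<dots> = (e \<ominus> e \<otimes> f) \<oplus> (f \<ominus> e \<otimes> f)"
      unfolding f1 f2 f3 using c by (simp add: a_minus_def)
    also have "\<dots> = s e f" unfolding s_def using c by (simp add: a_minus_def minus_add a_ac)
    finally show ?thesis using c' by (simp add: idempotents_def)
  qed
  have s_zero: "s \<zero> x = x" if "x \<in> carrier R" for x
    using that by (simp add: s_def a_minus_def)
  have s_self: "s e e = \<zero>" if "e \<in> idempotents R" for e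
    using that by (simp add: s_def a_minus_def idem carr r_neg)
  have zero_mem: "\<zero> \<in> idempotents R" and one_mem: "\<one> \<in> idempotents R"
    by (simp_all add: idempotents_def)
  show ?thesis
  proof (rule cringI)
    show "abelian_group (boolean_ring R)"
      by (rule abelian_groupI)
        (auto simp: s_closed zero_mem s_zero carr s_assoc intro: s_comm s_self)
    show "comm_monoid (boolean_ring R)"
      by (rule comm_monoidI) (auto simp: mult_closed one_mem carr m_assoc intro: m_comm)
    show "(x \<oplus>\<^bsub>boolean_ring R\<^esub> y) \<otimes>\<^bsub>boolean_ring R\<^esub> z
        = x \<otimes>\<^bsub>boolean_ring R\<^esub> z \<oplus>\<^bsub>boolean_ring R\<^esub> y \<otimes>\<^bsub>boolean_ring R\<^esub> z"
      if "x \<in> carrier (boolean_ring R)" "y \<in> carrier (boolean_ring R)"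
        "z \<in> carrier (boolean_ring R)" for x y z
    proof -
      have m: "x \<in> idempotents R" "y \<in> idempotents R" "z \<in> idempotents R"
        using that by simp_all
      have "s x y \<otimes> z = z \<otimes> s x y" using m by (simp add: carr s_carr m_comm)
      also have "\<dots> = (z \<otimes> x \<oplus> z \<otimes> y) \<ominus> (z \<otimes> (x \<otimes> y) \<oplus> z \<otimes> (x \<otimes> y))"
        using m by (simp add: distr carr)
      also have "\<dots> = s (x \<otimes> z) (y \<otimes> z)"
        unfolding s_def using m by (simp add: carr m_ac idem idem')
      finally show ?thesis by simp
    qed
  qed
qed

definition Spec :: "('a, 'b) ring_scheme \<Rightarrow> 'a set set" where
  "Spec R = {P. primeideal P R}"

definition zero_locus :: "('a, 'b) ring_scheme \<Rightarrow> 'a set \<Rightarrow> 'a set set" where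
  "zero_locus R S = {P \<in> Spec R. S \<subseteq> P}"

definition zariski_open :: "('a, 'b) ring_scheme \<Rightarrow> 'a set set \<Rightarrow> bool" where
  "zariski_open R U \<longleftrightarrow> (\<exists>S \<subseteq> carrier R. U = Spec R - zero_locus R S)"

definition zariski :: "('a, 'b) ring_scheme \<Rightarrow> 'a set topology" where
  "zariski R = topology (zariski_open R)"

text \<open>The library's \<^const>\<open>topology\<close> is only meaningful on predicates satisfying
  \<^const>\<open>istopology\<close>, so we verify this for \<^const>\<open>zariski_open\<close>.\<close>

lemma istopology_zariski_open:
  fixes R (structure)
  assumes "cring R"
  shows "istopology (zariski_open R)"
  unfolding istopology_def
proof (intro conjI allI impI)
  interpret cring R by fact
  fix U V assume "zariski_open R U" "zariski_open R V"
  then obtain S T where S: "S \<subseteq> carrier R" "U = Spec R - zero_locus R S"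
    and T: "T \<subseteq> carrier R" "V = Spec R - zero_locus R T"
    by (auto simp: zariski_open_def)
  define W where "W = {s \<otimes> t |s t. s \<in> S \<and> t \<in> T}"
  have "W \<subseteq> carrier R" using S T by (auto simp: W_def)
  moreover have "W \<subseteq> P \<longleftrightarrow> S \<subseteq> P \<or> T \<subseteq> P" if "P \<in> Spec R" for P
  proof -
    interpret P: primeideal P R using that by (simp add: Spec_def)
    show ?thesis
    proof
      assume W: "W \<subseteq> P"
      show "S \<subseteq> P \<or> T \<subseteq> P"
      proof (rule ccontr)
        assume "\<not> ?thesis"
        then obtain s t where "s \<in> S" "s \<notin> P" "t \<in> T" "t \<notin> P" by auto
        then show False using W S T P.I_prime[of s t] by (auto simp: W_def)
      qed
    next
      assume "S \<subseteq> P \<or> T \<subseteq> P"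
      then show "W \<subseteq> P"
        using S(1) T(1) P.I_l_closed P.I_r_closed unfolding W_def by blast
    qed
  qed
  ultimately show "zariski_open R (U \<inter> V)"
    unfolding zariski_open_def using S T
    by (intro exI[of _ W]) (auto simp: zero_locus_def)
next
  fix K assume "\<forall>U\<in>K. zariski_open R U"
  then obtain S where S: "\<And>U. U \<in> K \<Longrightarrow> S U \<subseteq> carrier R \<and> U = Spec R - zero_locus R (S U)"
    unfolding zariski_open_def by metis
  have "\<Union>K = Spec R - zero_locus R (\<Union>U\<in>K. S U)"
  proof (intro Set.set_eqI iffI)
    fix P assume "P \<in> \<Union>K"
    then obtain U where "U \<in> K" "P \<in> U" by blast
    then have "P \<in> Spec R" "\<not> S U \<subseteq> P" using S[of U] by (auto simp: zero_locus_def)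
    then show "P \<in> Spec R - zero_locus R (\<Union>U\<in>K. S U)"
      using \<open>U \<in> K\<close> by (auto simp: zero_locus_def)
  next
    fix P assume "P \<in> Spec R - zero_locus R (\<Union>U\<in>K. S U)"
    then obtain U where U: "U \<in> K" "P \<in> Spec R" "\<not> S U \<subseteq> P" by (auto simp: zero_locus_def)
    then have "P \<in> Spec R - zero_locus R (S U)" by (auto simp: zero_locus_def)
    then show "P \<in> \<Union>K" using S[OF U(1)] U(1) by blast
  qed
  then show "zariski_open R (\<Union>K)"
    unfolding zariski_open_def using S by (intro exI[of _ "\<Union>U\<in>K. S U"]) blast
qed

lemma openin_zariski: "cring R \<Longrightarrow> openin (zariski R) U \<longleftrightarrow> zariski_open R U"
  by (simp add: zariski_def topology_inverse' istopology_zariski_open)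

lemma topspace_zariski:
  fixes R (structure)
  assumes "cring R"
  shows "topspace (zariski R) = Spec R"
proof -
  interpret cring R by fact
  have "P \<noteq> carrier R \<and> P \<subseteq> carrier R" if "P \<in> Spec R" for P
  proof -
    interpret P: primeideal P R using that by (simp add: Spec_def)
    show ?thesis using P.I_notcarr P.a_subset by blast
  qed
  then have "zariski_open R (Spec R)"
    unfolding zariski_open_def zero_locus_def by (intro exI[of _ "carrier R"]) blast
  moreover have "U \<subseteq> Spec R" if "zariski_open R U" for U
    using that by (auto simp: zariski_open_def)
  ultimately show ?thesis
    unfolding topspace_def openin_zariski[OF assms] by blast
qed

definition totally_disconnected_space :: "'a topology \<Rightarrow> bool" where
  "totally_disconnected_space X \<longleftrightarrow>
     (\<forall>C. connectedin X C \<and> C \<noteq> {} \<longrightarrow> (\<exists>x. C = {x}))"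

end

theory Submission
  imports Defs
begin

text \<open>
  If every prime of \<open>R\<close> is maximal, then no prime avoids all the elements \<open>a\<^sup>n (1 - r a)\<close>, so one of
  them vanishes; then \<open>e = (r a)\<^sup>n\<close> is idempotent and lies in the same primes as \<open>a\<close>. These
  idempotents separate primes, so the spectrum is totally disconnected; and they show that the
  basic open sets of \<open>Spec R\<close> are given by idempotents, so that contraction
  \<open>P \<mapsto> P \<inter> \<B>(R)\<close>, always continuous and surjective, is a homeomorphism. Conversely, if
  \<open>P \<subseteq> Q\<close> are primes then \<open>{P, Q}\<close> is connected, so a totally disconnected spectrum has
  no proper inclusions. This applies when \<open>Spec R\<close> is homeomorphic to
  \<open>Spec \<B>(R)\<close>, since distinct primes of a Boolean ring are separated by an idempotent.
\<close>

section \<open>Prime ideals\<close>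

text \<open>Serves the two maximality arguments below, where an ideal maximal in some family is
  enlarged by a single element.\<close>

lemma (in cring) insert_subset_add_cgenideal:
  assumes I: "ideal I R" and a: "a \<in> carrier R"
  shows "insert a I \<subseteq> I <+> PIdl a"
proof -
  interpret I: ideal I R by fact
  interpret A: ideal "PIdl a" R using cgenideal_ideal[OF a] .
  have mem: "x \<oplus> y \<in> I <+> PIdl a" if "x \<in> I" "y \<in> PIdl a" for x y
    using that unfolding set_add_def' by blast
  show ?thesis
    using mem[OF I.zero_closed cgenideal_self[OF a]] mem[OF _ A.zero_closed] a I.Icarr by auto
qed

text \<open>Zorn's lemma gives an ideal \<open>M\<close> maximal among the ideals above
  \<open>I\<close> that avoid the multiplicative set \<open>S\<close>; such an \<open>M\<close> is
  automatically prime.\<close>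

lemma (in cring) exists_primeideal_disjoint:
  assumes I: "ideal I R" and S: "S \<subseteq> carrier R" "\<one> \<in> S"
    and mult: "\<And>s t. s \<in> S \<Longrightarrow> t \<in> S \<Longrightarrow> s \<otimes> t \<in> S"
    and disj: "I \<inter> S = {}"
  obtains P where "primeideal P R" "I \<subseteq> P" "P \<inter> S = {}"
proof -
  define \<A> where "\<A> = {J. ideal J R \<and> I \<subseteq> J \<and> J \<inter> S = {}}"
  have "\<exists>M\<in>\<A>. \<forall>X\<in>\<A>. M \<subseteq> X \<longrightarrow> X = M"
  proof (rule subset_Zorn_nonempty)
    show "\<A> \<noteq> {}" using I disj by (auto simp: \<A>_def)
  next
    fix \<C> assume "\<C> \<noteq> {}" and "subset.chain \<A> \<C>"
    then have ideal: "\<And>J. J \<in> \<C> \<Longrightarrow> ideal J R" and sup: "\<And>J. J \<in> \<C> \<Longrightarrow> I \<subseteq> J \<and> J \<inter> S = {}"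
      by (auto simp: subset.chain_def \<A>_def)
    have chain: "J \<subseteq> K \<or> K \<subseteq> J" if "J \<in> \<C>" "K \<in> \<C>" for J K
      using \<open>subset.chain \<A> \<C>\<close> that unfolding subset.chain_def by blast
    have "ideal (\<Union>\<C>) R"
    proof (rule idealI[OF ring_axioms])
      show "subgroup (\<Union>\<C>) (add_monoid R)"
      proof (rule add.subgroupI)
        show "\<Union>\<C> \<subseteq> carrier R" by (auto dest: ideal intro: ideal.Icarr)
        obtain J where "J \<in> \<C>" using \<open>\<C> \<noteq> {}\<close> by blast
        then have "\<zero> \<in> J"
          by (rule additive_subgroup.zero_closed[OF ideal.axioms(1)[OF ideal]])
        then show "\<Union>\<C> \<noteq> {}" using \<open>J \<in> \<C>\<close> by blast
      next
        fix x assume "x \<in> \<Union>\<C>"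
        then obtain J where J: "J \<in> \<C>" "x \<in> J" by blast
        then have "\<ominus> x \<in> J"
          using additive_subgroup.a_inv_closed[OF ideal.axioms(1)[OF ideal]] by simp
        then show "\<ominus> x \<in> \<Union>\<C>" using J by blast
      next
        fix x y assume "x \<in> \<Union>\<C>" "y \<in> \<Union>\<C>"
        then obtain J where J: "J \<in> \<C>" "x \<in> J" "y \<in> J" using chain by blast
        then have "x \<oplus> y \<in> J"
          using additive_subgroup.a_closed[OF ideal.axioms(1)[OF ideal]] by simp
        then show "x \<oplus> y \<in> \<Union>\<C>" using J by blast
      qed
    qed (auto dest: ideal intro: ideal.I_l_closed ideal.I_r_closed)
    then show "\<Union>\<C> \<in> \<A>"
      using \<open>\<C> \<noteq> {}\<close> sup unfolding \<A>_def by blast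
  qed
  then obtain M where "M \<in> \<A>" and max: "\<And>X. X \<in> \<A> \<Longrightarrow> M \<subseteq> X \<Longrightarrow> X = M"
    by blast
  then have M: "ideal M R" "I \<subseteq> M" "M \<inter> S = {}" by (auto simp: \<A>_def)
  interpret M: ideal M R by (fact M)
  \<comment> \<open>By maximality, the ideal generated by \<open>M\<close> and an outside element
    \<open>a\<close> can no longer avoid \<open>S\<close>.\<close>
  have meets: "\<exists>m\<in>M. \<exists>x\<in>carrier R. m \<oplus> x \<otimes> a \<in> S" if a: "a \<in> carrier R" "a \<notin> M" for a
  proof -
    have sub: "insert a M \<subseteq> M <+> PIdl a" using insert_subset_add_cgenideal[OF M(1) a(1)] .
    then have "M <+> PIdl a \<notin> \<A>" using max a(2) by blast
    then have "(M <+> PIdl a) \<inter> S \<noteq> {}"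
      using sub M(2) add_ideals[OF M(1) cgenideal_ideal[OF a(1)]] unfolding \<A>_def by blast
    then show ?thesis unfolding set_add_def' cgenideal_def by blast
  qed
  have "primeideal M R"
  proof (rule primeidealI[OF M(1) is_cring])
    show "carrier R \<noteq> M" using S M(3) by blast
    fix a b assume ab: "a \<in> carrier R" "b \<in> carrier R" "a \<otimes> b \<in> M"
    show "a \<in> M \<or> b \<in> M"
    proof (rule ccontr)
      assume "\<not> ?thesis"
      then obtain m x n y where *: "m \<in> M" "n \<in> M" "x \<in> carrier R" "y \<in> carrier R"
        "m \<oplus> x \<otimes> a \<in> S" "n \<oplus> y \<otimes> b \<in> S"
        using meets ab by meson
      \<comment> \<open>Each summand has a factor \<open>m\<close>, \<open>n\<close> or
        \<open>a \<otimes> b\<close>, all in \<open>M\<close>, while the product of two elements of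
        \<open>S\<close> stays in \<open>S\<close>.\<close>
      have "(m \<oplus> x \<otimes> a) \<otimes> (n \<oplus> y \<otimes> b) = m \<otimes> (n \<oplus> y \<otimes> b) \<oplus> ((x \<otimes> a) \<otimes> n \<oplus> (x \<otimes> y) \<otimes> (a \<otimes> b))"
        using * ab by (simp add: M.Icarr l_distr r_distr m_ac a_ac)
      moreover have "\<dots> \<in> M"
        using * ab by (intro M.a_closed M.I_r_closed[of m] M.I_l_closed[of n] M.I_l_closed[of "a \<otimes> b"])
          (auto simp: M.Icarr)
      ultimately show False using mult[OF *(5,6)] M(3) by auto
    qed
  qed
  then show thesis using that M by blast
qed

lemma (in primeideal) one_notin: "\<one> \<notin> I"
  using I_notcarr one_imp_carrier by blast

lemma (in primeideal) nat_pow_mem_imp_mem: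
  fixes n :: nat
  assumes "a \<in> carrier R" "a [^] n \<in> I"
  shows "a \<in> I"
  using assms(2)
proof (induction n)
  case 0
  then show ?case using one_notin by simp
next
  case (Suc n)
  then show ?case using I_prime[of "a [^] n" a] assms(1) by auto
qed

lemma (in primeideal) one_minus_mem_imp_notin:
  assumes "x \<in> carrier R" "\<one> \<ominus> x \<in> I"
  shows "x \<notin> I"
proof
  assume "x \<in> I"
  then have "(\<one> \<ominus> x) \<oplus> x \<in> I" using assms(2) a_closed by blast
  then show False using assms(1) one_notin by (simp add: a_minus_def a_assoc l_neg)
qed

section \<open>Idempotents and their complements\<close>

lemma (in cring) idempotent_complement:
  assumes "e \<in> idempotents R"
  shows "e \<otimes> (\<one> \<ominus> e) = \<zero>" "\<one> \<ominus> e \<in> idempotents R"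
proof -
  have e: "e \<in> carrier R" "e \<otimes> e = e" using assms by (auto simp: idempotents_def)
  then show *: "e \<otimes> (\<one> \<ominus> e) = \<zero>" by (simp add: a_minus_def r_distr r_minus r_neg)
  have "(\<one> \<ominus> e) \<otimes> f = f \<ominus> e \<otimes> f" if "f \<in> carrier R" for f
    using e(1) that by (simp add: a_minus_def l_distr l_minus)
  then have "(\<one> \<ominus> e) \<otimes> (\<one> \<ominus> e) = \<one> \<ominus> e"
    using e(1) * by (simp add: a_minus_def)
  then show "\<one> \<ominus> e \<in> idempotents R"
    using e(1) by (simp add: idempotents_def)
qed

text \<open>The product of \<open>e\<close> and its complement is zero, so a prime contains one of
  them; their sum is one, so it cannot contain both.\<close>

lemma (in primeideal) idempotent_complement_mem_iff:
  assumes "e \<in> idempotents R"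
  shows "\<one> \<ominus> e \<in> I \<longleftrightarrow> e \<notin> I"
proof -
  have "e \<in> carrier R" using assms by (simp add: idempotents_def)
  moreover have "e \<otimes> (\<one> \<ominus> e) \<in> I" using idempotent_complement(1)[OF assms] zero_closed by simp
  ultimately show ?thesis using I_prime minus_closed one_minus_mem_imp_notin by blast
qed

text \<open>A proper ideal \<open>J\<close> above \<open>P\<close> lies in some prime
  \<open>Q\<close>. If primes have no proper inclusions, then \<open>P = Q\<close>, which squeezes
  \<open>J\<close> to \<open>P\<close>.\<close>

lemma (in cring) maximal_iff_no_prime_inclusions:
  "(\<forall>P. primeideal P R \<longrightarrow> maximalideal P R) \<longleftrightarrow>
   (\<forall>P Q. primeideal P R \<and> primeideal Q R \<and> P \<subseteq> Q \<longrightarrow> P = Q)"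
proof (intro iffI allI impI)
  fix P Q
  assume "\<forall>P. primeideal P R \<longrightarrow> maximalideal P R"
    and PQ: "primeideal P R \<and> primeideal Q R \<and> P \<subseteq> Q"
  then interpret P: maximalideal P R by blast
  interpret Q: primeideal Q R using PQ by blast
  show "P = Q"
    using P.I_maximal[OF Q.is_ideal] PQ Q.I_notcarr Q.a_subset by blast
next
  fix P
  assume incl: "\<forall>P Q. primeideal P R \<and> primeideal Q R \<and> P \<subseteq> Q \<longrightarrow> P = Q"
    and P: "primeideal P R"
  interpret P: primeideal P R by fact
  show "maximalideal P R"
  proof (rule maximalidealI[OF P.is_ideal P.I_notcarr])
    fix J assume J: "ideal J R" "P \<subseteq> J" "J \<subseteq> carrier R"
    show "J = P \<or> J = carrier R"
    proof (cases "\<one> \<in> J")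
      case True
      then show ?thesis using ideal.one_imp_carrier[OF J(1)] by blast
    next
      case False
      then obtain Q where "primeideal Q R" "J \<subseteq> Q"
        using exists_primeideal_disjoint[OF J(1), of "{\<one>}"] by auto
      then show ?thesis using incl P J by blast
    qed
  qed
qed

section \<open>Idempotents in zero-dimensional rings\<close>

text \<open>Otherwise some prime avoids all these elements. It is maximal and omits
  \<open>a\<close>, so \<open>a\<close> is invertible modulo it; an inverse \<open>r\<close> puts
  \<open>\<one> \<ominus> r \<otimes> a\<close> into the prime, although this is one of the avoided
  elements.\<close>

lemma (in cring) zero_dim_pi_regular:
  assumes dim0: "\<And>P. primeideal P R \<Longrightarrow> maximalideal P R" and a: "a \<in> carrier R"
  obtains n :: nat and r where "r \<in> carrier R" "a [^] n \<otimes> (\<one> \<ominus> r \<otimes> a) = \<zero>"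
proof (rule ccontr)
  assume not: "\<not> thesis"
  define S where "S = {a [^] n \<otimes> (\<one> \<ominus> r \<otimes> a) |(n::nat) r. r \<in> carrier R}"
  have mem: "a [^] n \<otimes> (\<one> \<ominus> r \<otimes> a) \<in> S" if "r \<in> carrier R" for n :: nat and r
    using that by (auto simp: S_def)
  have "{\<zero>} \<inter> S = {}" using not that unfolding S_def by force
  moreover have "S \<subseteq> carrier R" using a by (auto simp: S_def)
  moreover have "\<one> \<in> S" using mem[of \<zero> 0] a by (simp add: a_minus_def)
  moreover have "s \<otimes> t \<in> S" if "s \<in> S" "t \<in> S" for s t
  proof -
    obtain n :: nat and p where "p \<in> carrier R" "s = a [^] n \<otimes> (\<one> \<ominus> p \<otimes> a)"
      using \<open>s \<in> S\<close> unfolding S_def by blast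
    moreover obtain m :: nat and q where "q \<in> carrier R" "t = a [^] m \<otimes> (\<one> \<ominus> q \<otimes> a)"
      using \<open>t \<in> S\<close> unfolding S_def by blast
    ultimately have pq: "p \<in> carrier R" "q \<in> carrier R"
      "s = a [^] n \<otimes> (\<one> \<ominus> p \<otimes> a)" "t = a [^] m \<otimes> (\<one> \<ominus> q \<otimes> a)"
      by blast+
    \<comment> \<open>This identity supplies the new coefficient of \<open>a\<close> that makes
      \<open>S\<close> closed under multiplication; the exponents simply add.\<close>
    have "(\<one> \<ominus> p \<otimes> a) \<otimes> (\<one> \<ominus> q \<otimes> a) = \<one> \<ominus> ((p \<oplus> q) \<ominus> (p \<otimes> a) \<otimes> q) \<otimes> a"
      using a pq(1,2)
      by (simp add: a_minus_def l_distr r_distr l_minus r_minus minus_add a_ac m_ac)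
    moreover have "s \<otimes> t = a [^] (n + m) \<otimes> ((\<one> \<ominus> p \<otimes> a) \<otimes> (\<one> \<ominus> q \<otimes> a))"
      using a pq by (simp add: nat_pow_mult[symmetric] m_ac)
    ultimately show ?thesis using mem a pq(1,2) by simp
  qed
  ultimately obtain P where P: "primeideal P R" "P \<inter> S = {}"
    using exists_primeideal_disjoint[OF zeroideal] by metis
  interpret P: maximalideal P R using P dim0 by blast
  \<comment> \<open>With exponent one and coefficient zero, \<open>a\<close> itself is an element of
    \<open>S\<close>.\<close>
  have "a \<notin> P" using mem[of \<zero> 1] P(2) a by (auto simp: a_minus_def)
  have Pa: "ideal (P <+> PIdl a) R" using add_ideals[OF P.is_ideal cgenideal_ideal[OF a]] .
  have "insert a P \<subseteq> P <+> PIdl a" using insert_subset_add_cgenideal[OF P.is_ideal a] .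
  then have "P <+> PIdl a = carrier R"
    using P.I_maximal[OF Pa] ideal.Icarr[OF Pa] \<open>a \<notin> P\<close> by auto
  then obtain p r where pr: "p \<in> P" "r \<in> carrier R" "\<one> = p \<oplus> r \<otimes> a"
    using one_closed unfolding set_add_def' cgenideal_def by blast
  then have "\<one> \<ominus> r \<otimes> a = p" using a by (simp add: P.Icarr a_minus_def a_assoc r_neg)
  moreover have "\<one> \<ominus> r \<otimes> a \<in> S" using mem[OF pr(2), of 0] a pr(2) by simp
  ultimately show False using pr(1) P(2) by blast
qed

lemma (in cring) zero_dim_idempotent_same_primes:
  assumes dim0: "\<And>P. primeideal P R \<Longrightarrow> maximalideal P R" and a: "a \<in> carrier R"
  obtains e where "e \<in> idempotents R" "\<And>P. primeideal P R \<Longrightarrow> e \<in> P \<longleftrightarrow> a \<in> P"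
proof -
  obtain n :: nat and r where r: "r \<in> carrier R" and n: "a [^] n \<otimes> (\<one> \<ominus> r \<otimes> a) = \<zero>"
    using zero_dim_pi_regular[OF dim0 a] by blast
  define x where "x = r \<otimes> a"
  have x: "x \<in> carrier R" using r a by (simp add: x_def)
  \<comment> \<open>Multiplying the relation for \<open>a\<close> by \<open>r [^] n\<close> makes it
    a relation in \<open>x\<close> alone.\<close>
  have "x [^] n \<otimes> (\<one> \<ominus> x) = r [^] n \<otimes> (a [^] n \<otimes> (\<one> \<ominus> x))"
    using r a by (simp add: x_def nat_pow_distrib m_assoc)
  then have "x [^] n \<otimes> (\<one> \<ominus> x) = \<zero>" using n r by (simp add: x_def)
  moreover have "x [^] n = x [^] n \<otimes> (\<one> \<ominus> x) \<oplus> x [^] n \<otimes> x"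
    using x by (simp add: a_minus_def r_distr r_minus a_assoc l_neg)
  ultimately have step: "x [^] n \<otimes> x = x [^] n" using x by simp
  \<comment> \<open>Since \<open>x [^] n\<close> absorbs \<open>x\<close>, it absorbs every power of
    \<open>x\<close>; the case \<open>k = n\<close> is idempotency.\<close>
  have "x [^] n \<otimes> x [^] k = x [^] n" for k :: nat
    using x step by (induction k) (simp_all add: m_assoc[symmetric])
  then have "x [^] n \<in> idempotents R" using x by (simp add: idempotents_def)
  moreover have "x [^] n \<in> P \<longleftrightarrow> a \<in> P" if "primeideal P R" for P
  proof
    interpret P: primeideal P R by fact
    show "x [^] n \<in> P" if "a \<in> P"
    proof -
      have "x \<in> P" using that r P.I_l_closed by (simp add: x_def)
      \<comment> \<open>The extra factor \<open>x\<close> covers the exponent \<open>n = 0\<close>,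
        where \<open>x [^] n\<close> does not visibly contain a factor from
        \<open>P\<close>.\<close>
      then have "x [^] n \<otimes> x \<in> P" using x P.I_l_closed by simp
      then show ?thesis by (simp add: step)
    qed
    show "a \<in> P" if "x [^] n \<in> P"
    proof -
      have "x \<in> P" using P.nat_pow_mem_imp_mem x that by blast
      then have "\<one> \<ominus> x \<notin> P" using P.one_minus_mem_imp_notin x by blast
      moreover have "a [^] n \<otimes> (\<one> \<ominus> x) \<in> P" using n P.zero_closed by (simp add: x_def)
      ultimately have "a [^] n \<in> P"
        using P.I_prime nat_pow_closed[OF a] minus_closed[OF one_closed x] by blast
      then show ?thesis using P.nat_pow_mem_imp_mem a by blast
    qed
  qed
  ultimately show thesis using that by blast
qed

text \<open>In dimension zero \<open>P\<close> is not contained in \<open>Q\<close>, and an element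
  of \<open>P\<close> outside \<open>Q\<close> can be exchanged for an idempotent lying in the same
  primes. Conversely, separation rules out proper inclusions.\<close>

lemma (in cring) zero_dim_iff_separated:
  "(\<forall>P. primeideal P R \<longrightarrow> maximalideal P R) \<longleftrightarrow>
   (\<forall>P Q. primeideal P R \<and> primeideal Q R \<and> P \<noteq> Q \<longrightarrow> (\<exists>e. e \<in> idempotents R \<and> e \<in> P - Q))"
  (is "?dim0 \<longleftrightarrow> ?sep")
proof
  assume dim0: ?dim0
  show ?sep
  proof (intro allI impI)
    fix P Q assume PQ: "primeideal P R \<and> primeideal Q R \<and> P \<noteq> Q"
    then obtain a where a: "a \<in> P" "a \<notin> Q"
      using dim0 maximal_iff_no_prime_inclusions by blast
    then have "a \<in> carrier R" using PQ ideal.Icarr primeideal.axioms(1) by metis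
    then obtain e where "e \<in> idempotents R" "\<And>P. primeideal P R \<Longrightarrow> e \<in> P \<longleftrightarrow> a \<in> P"
      using zero_dim_idempotent_same_primes dim0 by metis
    then show "\<exists>e. e \<in> idempotents R \<and> e \<in> P - Q" using PQ a by blast
  qed
next
  assume ?sep
  then show ?dim0 unfolding maximal_iff_no_prime_inclusions by blast
qed

section \<open>Connectedness in the spectrum\<close>

text \<open>The homeomorphism maps a nonempty connected set onto a connected set, hence onto a
  point, and injectivity brings the singleton back.\<close>

lemma totally_disconnected_space_homeomorphic:
  assumes "X homeomorphic_space Y" "totally_disconnected_space Y"
  shows "totally_disconnected_space X"
  unfolding totally_disconnected_space_def
proof (intro allI impI)
  fix C assume C: "connectedin X C \<and> C \<noteq> {}"
  obtain f where f: "homeomorphic_map X Y f"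
    using assms(1) by (auto simp: homeomorphic_space_def homeomorphic_maps_map)
  have sub: "C \<subseteq> topspace X" using C connectedin_subset_topspace by blast
  have "connectedin Y (f ` C)"
    using C connectedin_continuous_map_image homeomorphic_imp_continuous_map f by blast
  then obtain y where "f ` C = {y}"
    using assms(2) C unfolding totally_disconnected_space_def by (metis image_is_empty)
  moreover have "inj_on f C"
    using homeomorphic_imp_injective_map[OF f] sub inj_on_subset by blast
  ultimately show "\<exists>x. C = {x}" using C unfolding inj_on_def by blast
qed

text \<open>The two sets partition the spectrum, so each is clopen. The second is the basic open set
  of the complementary idempotent.\<close>

lemma zariski_open_idempotent:
  assumes "cring R" "e \<in> idempotents R"
  shows "zariski_open R {P \<in> Spec R. e \<notin> P}" "zariski_open R {P \<in> Spec R. e \<in> P}"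
proof -
  interpret cring R by fact
  have "e \<in> carrier R" using assms by (simp add: idempotents_def)
  then show "zariski_open R {P \<in> Spec R. e \<notin> P}"
    unfolding zariski_open_def zero_locus_def by (intro exI[of _ "{e}"]) auto
  have "{P \<in> Spec R. e \<in> P} = Spec R - zero_locus R {\<one>\<^bsub>R\<^esub> \<ominus>\<^bsub>R\<^esub> e}"
    using assms(2) by (auto simp: zero_locus_def Spec_def primeideal.idempotent_complement_mem_iff)
  then show "zariski_open R {P \<in> Spec R. e \<in> P}"
    using \<open>e \<in> carrier R\<close> unfolding zariski_open_def by (intro exI[of _ "{\<one>\<^bsub>R\<^esub> \<ominus>\<^bsub>R\<^esub> e}"]) auto
qed

lemma separated_imp_totally_disconnected:
  assumes R: "cring R"
    and sep: "\<And>P Q. primeideal P R \<Longrightarrow> primeideal Q R \<Longrightarrow> P \<noteq> Q \<Longrightarrow>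
      \<exists>e. e \<in> idempotents R \<and> e \<in> P - Q"
  shows "totally_disconnected_space (zariski R)"
  unfolding totally_disconnected_space_def
proof (intro allI impI)
  fix C assume C: "connectedin (zariski R) C \<and> C \<noteq> {}"
  then have sub: "C \<subseteq> Spec R"
    using connectedin_subset_topspace topspace_zariski[OF R] by blast
  have "P = Q" if PQ: "P \<in> C" "Q \<in> C" for P Q
  proof (rule ccontr)
    assume "P \<noteq> Q"
    moreover have "primeideal P R" "primeideal Q R" using sub PQ by (auto simp: Spec_def)
    ultimately obtain e where e: "e \<in> idempotents R" "e \<in> P" "e \<notin> Q"
      using sep by blast
    have "connectedin (zariski R) C" using C by blast
    then show False
      by (rule connectedinD[where ?E1.0 = "{P \<in> Spec R. e \<in> P}" and ?E2.0 = "{P \<in> Spec R. e \<notin> P}"])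
        (use PQ sub e zariski_open_idempotent[OF R e(1)] in \<open>auto simp: openin_zariski[OF R]\<close>)
  qed
  then show "\<exists>P. C = {P}" using C by blast
qed

text \<open>Every open set containing the larger prime \<open>Q\<close> also contains
  \<open>P\<close>, so no pair of open sets can separate the two points.\<close>

lemma connectedin_specialization:
  assumes R: "cring R" and PQ: "primeideal P R" "primeideal Q R" "P \<subseteq> Q"
  shows "connectedin (zariski R) {P, Q}"
proof -
  have gen: "P \<in> U" if "openin (zariski R) U" "Q \<in> U" for U
    using that PQ by (auto simp: openin_zariski[OF R] zariski_open_def zero_locus_def Spec_def)
  show ?thesis
    unfolding connectedin topspace_zariski[OF R]
    using gen PQ by (auto simp: Spec_def)
qed

lemma (in cring) zero_dim_iff_totally_disconnected:
  "(\<forall>P. primeideal P R \<longrightarrow> maximalideal P R) \<longleftrightarrow> totally_disconnected_space (zariski R)"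
proof
  assume "\<forall>P. primeideal P R \<longrightarrow> maximalideal P R"
  then show "totally_disconnected_space (zariski R)"
    using separated_imp_totally_disconnected[OF is_cring] zero_dim_iff_separated by blast
next
  assume td: "totally_disconnected_space (zariski R)"
  show "\<forall>P. primeideal P R \<longrightarrow> maximalideal P R"
    unfolding maximal_iff_no_prime_inclusions
  proof (intro allI impI)
    fix P Q assume "primeideal P R \<and> primeideal Q R \<and> P \<subseteq> Q"
    then have "connectedin (zariski R) {P, Q}" using connectedin_specialization[OF is_cring] by blast
    then obtain x where "{P, Q} = {x}"
      using td unfolding totally_disconnected_space_def by blast
    then show "P = Q" by blast
  qed
qed

section \<open>The Boolean ring of idempotents\<close>

lemma boolean_ring_simps [simp]:
  "carrier (boolean_ring R) = idempotents R"
  "mult (boolean_ring R) = mult R"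
  "one (boolean_ring R) = one R"
  "zero (boolean_ring R) = zero R"
  "idempotents (boolean_ring R) = idempotents R"
  by (auto simp: boolean_ring_def idempotents_def)

text \<open>Every element of \<open>boolean_ring R\<close> is idempotent. If \<open>p\<close> is not
  contained in \<open>q\<close>, any element of the difference separates them; otherwise the
  complement of an element of \<open>q\<close> outside \<open>p\<close> does.\<close>

lemma boolean_ring_separated:
  assumes R: "cring R"
    and pq: "primeideal p (boolean_ring R)" "primeideal q (boolean_ring R)" "p \<noteq> q"
  shows "\<exists>e. e \<in> idempotents (boolean_ring R) \<and> e \<in> p - q"
proof (cases "p \<subseteq> q")
  case False
  then obtain e where "e \<in> p" "e \<notin> q" by blast
  moreover have "e \<in> carrier (boolean_ring R)"
    using \<open>e \<in> p\<close> pq(1) ideal.Icarr primeideal.axioms(1) by metis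
  ultimately show ?thesis by auto
next
  case True
  then obtain e where e: "e \<in> q" "e \<notin> p" using pq(3) by blast
  have "e \<in> carrier (boolean_ring R)"
    using \<open>e \<in> q\<close> pq(2) ideal.Icarr primeideal.axioms(1) by metis
  then have "e \<in> idempotents (boolean_ring R)" by simp
  then show ?thesis
    using e pq(1,2) primeideal.idempotent_complement_mem_iff
      cring.idempotent_complement(2)[OF cring_boolean_ring[OF R]] by (metis DiffI)
qed

section \<open>Contraction of primes to the ring of idempotents\<close>

lemma contraction_primeideal:
  fixes R (structure)
  assumes "primeideal P R"
  shows "primeideal (P \<inter> idempotents R) (boolean_ring R)"
proof -
  interpret P: primeideal P R by fact
  interpret B: cring "boolean_ring R" using cring_boolean_ring[OF P.is_cring] .
  have add: "add (boolean_ring R) x y = (x \<oplus> y) \<ominus> (x \<otimes> y \<oplus> x \<otimes> y)" for x y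
    by (simp add: boolean_ring_def)
  have carr: "x \<in> carrier R" if "x \<in> idempotents R" for x
    using that by (simp add: idempotents_def)
  have absorb: "x \<otimes> a \<in> P \<inter> idempotents R" "a \<otimes> x \<in> P \<inter> idempotents R"
    if "a \<in> P \<inter> idempotents R" "x \<in> idempotents R" for a x
    using that carr B.m_closed[of x a] B.m_closed[of a x] P.I_l_closed P.I_r_closed by auto
  \<comment> \<open>The two rings have different additions, so the inclusion is in general no ring
    homomorphism and the ideal axioms are checked by hand.\<close>
  have "subgroup (P \<inter> idempotents R) (add_monoid (boolean_ring R))"
  proof (rule B.add.subgroupI)
    have "\<zero> \<in> P \<inter> idempotents R" using B.zero_closed P.zero_closed by simp
    then show "P \<inter> idempotents R \<noteq> {}" by blast
  next
    fix x assume x: "x \<in> P \<inter> idempotents R"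
    \<comment> \<open>Writing the negative as a multiple of \<open>x\<close> reduces closure under
      negation to absorption.\<close>
    have "\<ominus>\<^bsub>boolean_ring R\<^esub> x = (\<ominus>\<^bsub>boolean_ring R\<^esub> \<one>\<^bsub>boolean_ring R\<^esub>) \<otimes>\<^bsub>boolean_ring R\<^esub> x"
      using x B.l_minus[of "\<one>\<^bsub>boolean_ring R\<^esub>" x] B.l_one[of x] B.one_closed by simp
    also have "\<dots> \<in> P \<inter> idempotents R"
      using absorb(1)[OF x] B.a_inv_closed[OF B.one_closed] by simp
    finally show "\<ominus>\<^bsub>boolean_ring R\<^esub> x \<in> P \<inter> idempotents R" .
  next
    fix x y assume xy: "x \<in> P \<inter> idempotents R" "y \<in> P \<inter> idempotents R"
    then have "x \<oplus>\<^bsub>boolean_ring R\<^esub> y \<in> idempotents R"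
      using B.a_closed[of x y] by simp
    moreover have "(x \<oplus> y) \<ominus> (x \<otimes> y \<oplus> x \<otimes> y) \<in> P"
      using xy carr P.I_r_closed by (auto simp: a_minus_def)
    ultimately show "x \<oplus>\<^bsub>boolean_ring R\<^esub> y \<in> P \<inter> idempotents R" by (simp add: add)
  qed auto
  then have "ideal (P \<inter> idempotents R) (boolean_ring R)"
    using absorb by (intro idealI[OF B.ring_axioms]) auto
  then show ?thesis
  proof (rule primeidealI[OF _ B.is_cring])
    show "carrier (boolean_ring R) \<noteq> P \<inter> idempotents R"
      using B.one_closed P.one_notin by auto
  qed (use P.I_prime carr in auto)
qed

text \<open>
  For \<open>S = \<B>(R) \<setminus> p\<close>, the kernel of \<open>R \<rightarrow> S\<inverse>R\<close>
  contains \<open>p\<close> and misses \<open>S\<close>; any prime above it missing \<open>S\<close> contracts to \<open>p\<close>.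
\<close>

lemma contraction_surj:
  fixes R (structure)
  assumes R: "cring R" and p: "primeideal p (boolean_ring R)"
  obtains P where "primeideal P R" "P \<inter> idempotents R = p"
proof -
  interpret cring R by fact
  interpret p: primeideal p "boolean_ring R" by fact
  define S where "S = idempotents R - p"
  have carr: "h \<in> carrier R" if "h \<in> S" for h
    using that by (simp add: S_def idempotents_def)
  have S_one: "\<one> \<in> S" using p.one_notin p.one_closed by (simp add: S_def)
  have S_mult: "h \<otimes> k \<in> S" if "h \<in> S" "k \<in> S" for h k
    using that p.m_closed[of h k] p.I_prime[of h k] by (auto simp: S_def)
  define I where "I = {x \<in> carrier R. \<exists>h\<in>S. h \<otimes> x = \<zero>}"
  have absorb: "x \<otimes> a \<in> I" if "a \<in> I" "x \<in> carrier R" for a x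
  proof -
    obtain h where h: "h \<in> S" "h \<otimes> a = \<zero>" "a \<in> carrier R"
      using \<open>a \<in> I\<close> unfolding I_def by blast
    have "h \<otimes> (x \<otimes> a) = x \<otimes> (h \<otimes> a)"
      using m_lcomm[OF carr[OF h(1)] that(2) h(3)] .
    then show ?thesis using h that(2) unfolding I_def by auto
  qed
  have "subgroup I (add_monoid R)"
  proof (rule add.subgroupI)
    show "I \<subseteq> carrier R" by (auto simp: I_def)
    show "I \<noteq> {}" using S_one by (auto simp: I_def intro!: exI[of _ \<zero>] bexI[of _ \<one>])
  next
    fix x assume "x \<in> I"
    then show "\<ominus> x \<in> I" by (auto simp: I_def r_minus carr)
  next
    fix x y assume "x \<in> I" "y \<in> I"
    then obtain h k where hk: "h \<in> S" "k \<in> S" "h \<otimes> x = \<zero>" "k \<otimes> y = \<zero>"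
      and xy: "x \<in> carrier R" "y \<in> carrier R"
      by (auto simp: I_def)
    \<comment> \<open>The product of an annihilator of \<open>x\<close> and one of \<open>y\<close>
      annihilates both, and it stays in \<open>S\<close>.\<close>
    have "(h \<otimes> k) \<otimes> (x \<oplus> y) = k \<otimes> (h \<otimes> x) \<oplus> h \<otimes> (k \<otimes> y)"
      using hk(1,2) xy carr by (simp add: r_distr m_ac)
    also have "\<dots> = \<zero>" using hk carr by simp
    finally show "x \<oplus> y \<in> I" using S_mult[OF hk(1,2)] xy by (auto simp: I_def)
  qed
  then have "ideal I R"
    using absorb m_comm by (intro idealI[OF ring_axioms]) (auto simp: I_def)
  moreover have "I \<inter> S = {}"
  proof -
    \<comment> \<open>An element of \<open>S\<close> killed by some \<open>h\<close> in
      \<open>S\<close> would put zero into \<open>S\<close>.\<close>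
    have "\<zero> \<notin> S" using additive_subgroup.zero_closed[OF p.is_additive_subgroup] by (simp add: S_def)
    then show ?thesis using S_mult unfolding I_def by force
  qed
  ultimately obtain P where P: "primeideal P R" "I \<subseteq> P" "P \<inter> S = {}"
    using exists_primeideal_disjoint S_one S_mult carr by (metis subsetI)
  have "p \<subseteq> I"
  proof
    fix e assume e: "e \<in> p"
    then have ide: "e \<in> idempotents R" using p.Icarr by simp
    \<comment> \<open>The complement is formed in the Boolean ring, where \<open>p\<close> is prime.
      As multiplication is that of \<open>R\<close>, it annihilates \<open>e\<close> in
      \<open>R\<close> too.\<close>
    let ?h = "\<one>\<^bsub>boolean_ring R\<^esub> \<ominus>\<^bsub>boolean_ring R\<^esub> e"
    have h: "e \<otimes> ?h = \<zero>" "?h \<in> S"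
      using p.idempotent_complement[of e] p.idempotent_complement_mem_iff[of e] e ide
      by (simp_all add: S_def)
    moreover have ec: "e \<in> carrier R" using ide by (simp add: idempotents_def)
    ultimately have "?h \<otimes> e = \<zero>" using m_comm[OF ec carr[OF h(2)]] by simp
    then show "e \<in> I" using h(2) ec unfolding I_def by blast
  qed
  moreover have "p \<subseteq> idempotents R" using p.Icarr by auto
  ultimately have "P \<inter> idempotents R = p" using P unfolding S_def by blast
  then show thesis using that P by blast
qed

text \<open>Dimension zero enters twice: primes are separated by idempotents, so contraction is
  injective; and each element defining an open set can be exchanged for an idempotent in the same
  primes, so contraction is open.\<close>

lemma zero_dim_imp_homeomorphic_boolean:
  fixes R (structure)
  assumes R: "cring R" and dim0: "\<forall>P. primeideal P R \<longrightarrow> maximalideal P R"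
  shows "zariski R homeomorphic_space zariski (boolean_ring R)"
proof -
  interpret cring R by fact
  note B = cring_boolean_ring[OF R]
  define f where "f = (\<lambda>P. P \<inter> idempotents R)"
  have f_Spec: "f P \<in> Spec (boolean_ring R)" if "P \<in> Spec R" for P
    using that contraction_primeideal by (auto simp: Spec_def f_def)
  have surj: "f ` Spec R = Spec (boolean_ring R)"
  proof
    show "Spec (boolean_ring R) \<subseteq> f ` Spec R"
    proof
      fix p assume "p \<in> Spec (boolean_ring R)"
      then obtain P where "primeideal P R" "P \<inter> idempotents R = p"
        using contraction_surj[OF R] by (auto simp: Spec_def)
      then show "p \<in> f ` Spec R" by (auto simp: f_def Spec_def)
    qed
  qed (use f_Spec in blast)
  have inj: "inj_on f (Spec R)"
  proof (rule inj_onI, rule ccontr)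
    fix P Q assume PQ: "P \<in> Spec R" "Q \<in> Spec R" "f P = f Q" "P \<noteq> Q"
    then obtain e where "e \<in> idempotents R" "e \<in> P - Q"
      using dim0 zero_dim_iff_separated unfolding Spec_def by blast
    then show False using PQ(3) by (auto simp: f_def)
  qed
  have cont: "continuous_map (zariski R) (zariski (boolean_ring R)) f"
    unfolding continuous_map topspace_zariski[OF R] topspace_zariski[OF B]
      openin_zariski[OF R] openin_zariski[OF B]
  proof (intro conjI allI impI)
    show "f ` Spec R \<subseteq> Spec (boolean_ring R)" using surj by blast
    fix V assume "zariski_open (boolean_ring R) V"
    then obtain T where T: "T \<subseteq> idempotents R" "V = Spec (boolean_ring R) - zero_locus (boolean_ring R) T"
      by (auto simp: zariski_open_def)
    \<comment> \<open>As \<open>T\<close> consists of idempotents, it lies in \<open>P\<close>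
      exactly when it lies in the contraction of \<open>P\<close>; the same set \<open>T\<close>
      thus defines the preimage.\<close>
    have "{P \<in> Spec R. f P \<in> V} = Spec R - zero_locus R T"
      using T f_Spec by (auto simp: zero_locus_def f_def)
    moreover have "T \<subseteq> carrier R" using T(1) by (auto simp: idempotents_def)
    ultimately show "zariski_open R {P \<in> Spec R. f P \<in> V}" unfolding zariski_open_def by blast
  qed
  have op: "open_map (zariski R) (zariski (boolean_ring R)) f"
    unfolding open_map_def openin_zariski[OF R] openin_zariski[OF B]
  proof (intro allI impI)
    fix U assume "zariski_open R U"
    then obtain S where S: "S \<subseteq> carrier R" "U = Spec R - zero_locus R S"
      by (auto simp: zariski_open_def)
    have "\<exists>e. e \<in> idempotents R \<and> (\<forall>P\<in>Spec R. e \<in> P \<longleftrightarrow> a \<in> P)" if a: "a \<in> carrier R" for a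
      using zero_dim_idempotent_same_primes[OF _ a] dim0 unfolding Spec_def by (metis mem_Collect_eq)
    then obtain E where E: "\<And>a. a \<in> carrier R \<Longrightarrow> E a \<in> idempotents R"
      "\<And>a P. a \<in> carrier R \<Longrightarrow> P \<in> Spec R \<Longrightarrow> E a \<in> P \<longleftrightarrow> a \<in> P"
      by metis
    have ES: "E ` S \<subseteq> idempotents R" using E(1) S(1) by blast
    have "S \<subseteq> P \<longleftrightarrow> E ` S \<subseteq> f P" if "P \<in> Spec R" for P
      using that E S(1) unfolding f_def by blast
    then have "U = {P \<in> Spec R. \<not> E ` S \<subseteq> f P}" using S(2) by (auto simp: zero_locus_def)
    \<comment> \<open>Membership in \<open>U\<close> now depends on \<open>P\<close> only through
      \<open>f P\<close>, so the condition passes unchanged to the image.\<close>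
    then have "f ` U = {p \<in> f ` Spec R. \<not> E ` S \<subseteq> p}" by blast
    also have "\<dots> = Spec (boolean_ring R) - zero_locus (boolean_ring R) (E ` S)"
      unfolding surj zero_locus_def by blast
    finally show "zariski_open (boolean_ring R) (f ` U)"
      unfolding zariski_open_def using ES by auto
  qed
  have "homeomorphic_map (zariski R) (zariski (boolean_ring R)) f"
    using bijective_open_imp_homeomorphic_map[OF cont op] surj inj
    by (simp add: topspace_zariski R B)
  then show ?thesis by (rule homeomorphic_map_imp_homeomorphic_space)
qed

theorem lemma3p22:
  fixes R :: "('a, 'b) ring_scheme"
  assumes "cring R"
  shows "((\<forall>P. primeideal P R \<longrightarrow> maximalideal P R) \<longleftrightarrow>
          (\<forall>P Q. primeideal P R \<and> primeideal Q R \<and> P \<noteq> Q \<longrightarrow>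
             (\<exists>e. e \<in> idempotents R \<and> e \<in> P - Q)))
       \<and> ((\<forall>P. primeideal P R \<longrightarrow> maximalideal P R) \<longleftrightarrow>
          totally_disconnected_space (zariski R))
       \<and> ((\<forall>P. primeideal P R \<longrightarrow> maximalideal P R) \<longleftrightarrow>
          zariski R homeomorphic_space zariski (boolean_ring R))"
proof (intro conjI)
  interpret cring R by fact
  show "(\<forall>P. primeideal P R \<longrightarrow> maximalideal P R) \<longleftrightarrow>
          (\<forall>P Q. primeideal P R \<and> primeideal Q R \<and> P \<noteq> Q \<longrightarrow>
             (\<exists>e. e \<in> idempotents R \<and> e \<in> P - Q))"
    by (rule zero_dim_iff_separated)
  show "(\<forall>P. primeideal P R \<longrightarrow> maximalideal P R) \<longleftrightarrow> totally_disconnected_space (zariski R)"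
    by (rule zero_dim_iff_totally_disconnected)
  \<comment> \<open>The spectrum of a Boolean ring is always totally disconnected, and a
    homeomorphism transfers this to the spectrum of \<open>R\<close>, which then has dimension zero
    by the previous equivalence.\<close>
  have "totally_disconnected_space (zariski (boolean_ring R))"
    using separated_imp_totally_disconnected[OF cring_boolean_ring[OF assms]]
      boolean_ring_separated[OF assms] by blast
  then show "(\<forall>P. primeideal P R \<longrightarrow> maximalideal P R) \<longleftrightarrow>
      zariski R homeomorphic_space zariski (boolean_ring R)"
    using zero_dim_imp_homeomorphic_boolean[OF assms] zero_dim_iff_totally_disconnected
      totally_disconnected_space_homeomorphic by blast
qed

end
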